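(* There exist constants $\varepsilon,\delta>0$ such that every (randomized) $(1-\varepsilon)$-approximation algorithm for the max ones problem has Lipschitz constant $\Omega(n^{\delta})$, where $n$ is the number of variables; i.e., there are instances with $n$ variables (for infinitely many/all large $n$) on which the Lipschitz constant of the algorithm, with respect to changes of the weight function for the fixed 3CNF formula, is at least $c\,n^{\delta}$ for a constant $c>0$.
   Context: Max ones problem: an instance is a 3CNF formula $\Phi$ over a variable set $X$ and a weight function $w:X\to\mathbb{R}_{\ge0}$; a solution is a satisfying assignment $\sigma:X\to\{0,1\}$, identified with the set $\sigma^{-1}(1)$, and the objective is to maximize $w(\sigma^{-1}(1))=\sum_{x\in\sigma^{-1}(1)}w(x)$. A $(1-\varepsilon)$-approximation algorithm always outputs a satisfying assignment whose expected weight is at least $(1-\varepsilon)$ times the optimum. Weighted Hamming distance: for $A,A'\subseteq X$ and $w,w'$, $d_{\mathrm w}((A,w),(A',w'))=\sum_{x\in A\cap A'}|w(x)-w'(x)|+\sum_{x\in A\setminus A'}w(x)+\sum_{x\in A'\setminus A}w'(x)$; $\mathrm{EM}$ is the infimum over couplings of the output distributions of the expected $d_{\mathrm w}$. The Lipschitz constant of algorithm $\mathcal A$ on formula $\Phi$ is $\sup_{w\neq w'}\mathrm{EM}((\mathcal A(\Phi,w),w),(\mathcal A(\Phi,w'),w'))/\|w-w'\|_1$, with $\mathcal A(\Phi,w)$ the distribution of $\sigma^{-1}(1)$. *)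

theory Defs
  imports "HOL-Probability.Probability"
begin

text \<open>Variables of an instance with n variables are the naturals 0..n-1.
  A literal is (variable, polarity): (x, True) is x, (x, False) is not x.
  A 3CNF formula is a list of clauses, each a list of exactly 3 literals
  (repetition allowed, so clauses of 1 or 2 distinct literals are covered).\<close>

type_synonym lit = "nat \<times> bool"
type_synonym cnf = "lit list list"

definition is_3cnf :: "nat \<Rightarrow> cnf \<Rightarrow> bool" where
  "is_3cnf n \<Phi> \<longleftrightarrow> (\<forall>C\<in>set \<Phi>. length C = 3 \<and> (\<forall>l\<in>set C. fst l < n))"

text \<open>An assignment sigma is identified with the set of variables set to 1.\<close>
definition sat :: "nat set \<Rightarrow> cnf \<Rightarrow> bool" where
  "sat A \<Phi> \<longleftrightarrow> (\<forall>C\<in>set \<Phi>. \<exists>l\<in>set C. (fst l \<in> A) = snd l)"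

definition solutions :: "nat \<Rightarrow> cnf \<Rightarrow> nat set set" where
  "solutions n \<Phi> = {A. A \<subseteq> {..<n} \<and> sat A \<Phi>}"

definition satisfiable :: "nat \<Rightarrow> cnf \<Rightarrow> bool" where
  "satisfiable n \<Phi> \<longleftrightarrow> solutions n \<Phi> \<noteq> {}"

text \<open>Weight functions on the variable set {..<n}: nonnegative there, zero outside
  (values outside the variable set are irrelevant and fixed to 0).\<close>
definition valid_weight :: "nat \<Rightarrow> (nat \<Rightarrow> real) \<Rightarrow> bool" where
  "valid_weight n w \<longleftrightarrow> (\<forall>x<n. 0 \<le> w x) \<and> (\<forall>x\<ge>n. w x = 0)"

definition wt :: "(nat \<Rightarrow> real) \<Rightarrow> nat set \<Rightarrow> real" where
  "wt w A = (\<Sum>x\<in>A. w x)"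

definition OPT :: "nat \<Rightarrow> cnf \<Rightarrow> (nat \<Rightarrow> real) \<Rightarrow> real" where
  "OPT n \<Phi> w = Max (wt w ` solutions n \<Phi>)"

type_synonym algorithm = "nat \<Rightarrow> cnf \<Rightarrow> (nat \<Rightarrow> real) \<Rightarrow> nat set pmf"

definition approx_alg :: "real \<Rightarrow> algorithm \<Rightarrow> bool" where
  "approx_alg \<epsilon> alg \<longleftrightarrow>
     (\<forall>n \<Phi> w. is_3cnf n \<Phi> \<and> satisfiable n \<Phi> \<and> valid_weight n w \<longrightarrow>
        (\<forall>A\<in>set_pmf (alg n \<Phi> w). A \<in> solutions n \<Phi>) \<and>
        measure_pmf.expectation (alg n \<Phi> w) (wt w) \<ge> (1 - \<epsilon>) * OPT n \<Phi> w)"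

definition dw :: "nat set \<times> (nat \<Rightarrow> real) \<Rightarrow> nat set \<times> (nat \<Rightarrow> real) \<Rightarrow> real" where
  "dw Aw Bw' = (let A = fst Aw; w = snd Aw; B = fst Bw'; w' = snd Bw' in
     (\<Sum>x\<in>A \<inter> B. \<bar>w x - w' x\<bar>) + (\<Sum>x\<in>A - B. w x) + (\<Sum>x\<in>B - A. w' x))"

definition couplings :: "'a pmf \<Rightarrow> 'b pmf \<Rightarrow> ('a \<times> 'b) pmf set" where
  "couplings p q = {r. map_pmf fst r = p \<and> map_pmf snd r = q}"

definition EM :: "nat set pmf \<times> (nat \<Rightarrow> real) \<Rightarrow> nat set pmf \<times> (nat \<Rightarrow> real) \<Rightarrow> real" where
  "EM Pw Qw' = Inf ((\<lambda>r. measure_pmf.expectation r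
        (\<lambda>(A, B). dw (A, snd Pw) (B, snd Qw'))) ` couplings (fst Pw) (fst Qw'))"

definition l1_dist :: "nat \<Rightarrow> (nat \<Rightarrow> real) \<Rightarrow> (nat \<Rightarrow> real) \<Rightarrow> real" where
  "l1_dist n w w' = (\<Sum>x<n. \<bar>w x - w' x\<bar>)"

definition lipschitz_const :: "algorithm \<Rightarrow> nat \<Rightarrow> cnf \<Rightarrow> ereal" where
  "lipschitz_const alg n \<Phi> =
     (SUP ww' \<in> {(w, w'). valid_weight n w \<and> valid_weight n w' \<and> w \<noteq> w'}.
        ereal (EM (alg n \<Phi> (fst ww'), fst ww') (alg n \<Phi> (snd ww'), snd ww')
               / l1_dist n (fst ww') (snd ww')))"

end

theory Submission
  imports Defs
begin

text \<open>
  The \<open>r\<close>-th tensor power of the parity code \<open>[3,2,2]\<close> has length \<open>3^r\<close>, dimension \<open>2^r\<close> and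
  distance \<open>2^r\<close>, and its parity checks have exactly three variables. Take a variable for every
  code bit and one for its negation, so that every solution contains exactly one of the two. Give
  all of them weight \<open>(2/3)^r\<close>, and let a target \<open>b\<close> put an additional weight \<open>1\<close> on the literals by
  which the \<open>2^r\<close> information bits agree with \<open>b\<close>. The two parts contribute \<open>2^r\<close> each to the
  optimum, so an approximate solution gets most information bits right. Averaging over \<open>b\<close> and over
  the information bits \<open>j\<close> yields \<open>b\<close> and \<open>j\<close> such that, both for \<open>b\<close> and for \<open>b\<close> flipped at \<open>j\<close>, the
  output is right at \<open>j\<close> with good probability. The flip costs only \<open>2\<close> in the weights, but
  it replaces the codeword by one at Hamming distance at least \<open>2^r\<close>, that is, at weighted distance
  at least \<open>2 (4/3)^r\<close>, which is polynomial in the number \<open>2 3^r\<close> of variables.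
\<close>

section \<open>Tensor powers of the parity code\<close>

text \<open>Position \<open>p < 3^r\<close> stands for its vector of \<open>r\<close> ternary digits; the checks are the axis-parallel
  lines, and the information positions are those with all digits in \<open>{0,1}\<close>.\<close>

fun checks :: "nat \<Rightarrow> (nat \<times> nat \<times> nat) list" where
  "checks 0 = []"
| "checks (Suc r) = checks r
     @ map (\<lambda>(a, b, c). (3 ^ r + a, 3 ^ r + b, 3 ^ r + c)) (checks r)
     @ map (\<lambda>(a, b, c). (2 * 3 ^ r + a, 2 * 3 ^ r + b, 2 * 3 ^ r + c)) (checks r)
     @ map (\<lambda>a. (a, 3 ^ r + a, 2 * 3 ^ r + a)) [0..<3 ^ r]"

definition codeword :: "nat \<Rightarrow> (nat \<Rightarrow> bool) \<Rightarrow> bool" where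
  "codeword r f \<longleftrightarrow> (\<forall>(a, b, c) \<in> set (checks r). f c = (f a \<noteq> f b))"

fun info :: "nat \<Rightarrow> nat set" where
  "info 0 = {0}"
| "info (Suc r) = info r \<union> (+) (3 ^ r) ` info r"

lemma codeword_0: "codeword 0 f"
  by (simp add: codeword_def)

text \<open>The leading ternary digit splits a word into three blocks; this recursion drives the
  inductions on the information bits and on the distance.\<close>

lemma codeword_Suc:
  "codeword (Suc r) f \<longleftrightarrow> codeword r f \<and> codeword r (\<lambda>a. f (3 ^ r + a)) \<and>
     codeword r (\<lambda>a. f (2 * 3 ^ r + a)) \<and>
     (\<forall>a<3 ^ r. f (2 * 3 ^ r + a) = (f a \<noteq> f (3 ^ r + a)))"
  by (auto simp: codeword_def ball_Un split_beta)

lemma checks_bounded: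
  "(a, b, c) \<in> set (checks r) \<Longrightarrow> a < 3 ^ r \<and> b < 3 ^ r \<and> c < 3 ^ r"
  by (induction r arbitrary: a b c) fastforce+

lemma codeword_cong:
  assumes "\<And>p. p < 3 ^ r \<Longrightarrow> f p = g p"
  shows "codeword r f = codeword r g"
proof -
  have "(case t of (a, b, c) \<Rightarrow> f c = (f a \<noteq> f b)) = (case t of (a, b, c) \<Rightarrow> g c = (g a \<noteq> g b))"
    if "t \<in> set (checks r)" for t
    using that assms checks_bounded[of _ _ _ r] by (cases t) auto
  then show ?thesis by (simp add: codeword_def)
qed

lemma codeword_xor:
  "codeword r f \<Longrightarrow> codeword r g \<Longrightarrow> codeword r (\<lambda>p. f p \<noteq> g p)"
  by (fastforce simp: codeword_def)

lemma info_bounded: "info r \<subseteq> {..<3 ^ r}"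
  by (induction r) (fastforce)+

lemma finite_info: "finite (info r)"
  by (induction r) auto

lemma card_info: "card (info r) = 2 ^ r"
proof (induction r)
  case (Suc r)
  have "info r \<inter> (+) (3 ^ r) ` info r = {}"
    using info_bounded[of r] by fastforce
  then show ?case
    using Suc by (simp add: card_Un_disjoint finite_info card_image)
qed simp

text \<open>The blocks with leading digit 0 and 1 are extended independently; their sum, a codeword
  by linearity, fills the third block, which holds no information position.\<close>

lemma codeword_extension: "\<exists>f. codeword r f \<and> (\<forall>p\<in>info r. f p = b p)"
proof (induction r arbitrary: b)
  case 0
  show ?case by (auto simp: codeword_0)
next
  case (Suc r)
  obtain g where g: "codeword r g" "\<forall>p\<in>info r. g p = b p"
    using Suc by blast
  obtain h where h: "codeword r h" "\<forall>p\<in>info r. h p = b (3 ^ r + p)"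
    using Suc[of "\<lambda>p. b (3 ^ r + p)"] by blast
  define f where "f = (\<lambda>p. if p < 3 ^ r then g p else if p < 2 * 3 ^ r then h (p - 3 ^ r)
     else g (p - 2 * 3 ^ r) \<noteq> h (p - 2 * 3 ^ r))"
  have "codeword r f"
    using g(1) codeword_cong[of r f g] by (simp add: f_def)
  moreover have "codeword r (\<lambda>a. f (3 ^ r + a))"
    using h(1) codeword_cong[of r "\<lambda>a. f (3 ^ r + a)" h] by (simp add: f_def)
  moreover have "codeword r (\<lambda>a. f (2 * 3 ^ r + a))"
    using codeword_xor[OF g(1) h(1)]
      codeword_cong[of r "\<lambda>a. f (2 * 3 ^ r + a)" "\<lambda>p. g p \<noteq> h p"] by (simp add: f_def)
  ultimately have "codeword (Suc r) f"
    by (auto simp: codeword_Suc f_def)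
  moreover have "\<forall>p\<in>info (Suc r). f p = b p"
    using g(2) h(2) info_bounded[of r] by (fastforce simp: f_def)
  ultimately show ?case by blast
qed

lemma sum_lessThan_add:
  fixes f :: "nat \<Rightarrow> 'a::comm_monoid_add"
  shows "sum f {..<m + n} = sum f {..<m} + (\<Sum>p<n. f (m + p))"
  by (induction n) (auto simp: add.assoc)

text \<open>Induction by blocks: a difference in one block forces one in a second, and each of the
  two contributes \<open>2 ^ r\<close>.\<close>

lemma codeword_distance:
  assumes "codeword r f" "codeword r g" "p < 3 ^ r" "f p \<noteq> g p"
  shows "2 ^ r \<le> card {p. p < 3 ^ r \<and> f p \<noteq> g p}"
proof -
  have "2 ^ r \<le> (\<Sum>p<3 ^ r. of_bool (f p \<noteq> g p) :: nat)"
    using assms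
  proof (induction r arbitrary: f g p)
    case 0
    then show ?case by simp
  next
    case (Suc r)
    define d where "d f g = (\<Sum>p<3 ^ r. of_bool (f p \<noteq> g p) :: nat)" for f g :: "nat \<Rightarrow> bool"
    have IH: "2 ^ r \<le> d f g" if "codeword r f" "codeword r g" "p < 3 ^ r" "f p \<noteq> g p" for f g p
      using Suc.IH[OF that] by (simp add: d_def)
    define f1 f2 g1 g2 where "f1 = (\<lambda>a. f (3 ^ r + a))" and "f2 = (\<lambda>a. f (2 * 3 ^ r + a))"
      and "g1 = (\<lambda>a. g (3 ^ r + a))" and "g2 = (\<lambda>a. g (2 * 3 ^ r + a))"
    have cw: "codeword r f" "codeword r f1" "codeword r f2"
      "codeword r g" "codeword r g1" "codeword r g2"
      and par: "\<And>a. a < 3 ^ r \<Longrightarrow> f2 a = (f a \<noteq> f1 a)" "\<And>a. a < 3 ^ r \<Longrightarrow> g2 a = (g a \<noteq> g1 a)"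
      using Suc.prems by (auto simp: codeword_Suc f1_def f2_def g1_def g2_def)
    have split: "(\<Sum>p<3 ^ Suc r. of_bool (f p \<noteq> g p) :: nat) = d f g + d f1 g1 + d f2 g2"
    proof -
      have "(3::nat) ^ Suc r = 2 * 3 ^ r + 3 ^ r" "(2::nat) * 3 ^ r = 3 ^ r + 3 ^ r" by simp_all
      then show ?thesis
        unfolding d_def f1_def f2_def g1_def g2_def by (simp only: sum_lessThan_add)
    qed
    obtain a where a: "a < 3 ^ r" "f a \<noteq> g a \<or> f1 a \<noteq> g1 a \<or> f2 a \<noteq> g2 a"
    proof -
      consider "p < 3 ^ r" | "3 ^ r \<le> p" "p < 2 * 3 ^ r" | "2 * 3 ^ r \<le> p" by linarith
      then show ?thesis
      proof cases
        case 1
        then show ?thesis using that[of p] Suc.prems by blast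
      next
        case 2
        then show ?thesis using that[of "p - 3 ^ r"] Suc.prems by (auto simp: f1_def g1_def)
      next
        case 3
        then show ?thesis using that[of "p - 2 * 3 ^ r"] Suc.prems by (auto simp: f2_def g2_def)
      qed
    qed
    \<comment> \<open>Both words satisfy the check through offset \<open>a\<close>, so the number of
      blocks differing there is even; being positive, it is 2.\<close>
    then consider "f a \<noteq> g a" "f1 a \<noteq> g1 a" | "f a \<noteq> g a" "f2 a \<noteq> g2 a" | "f1 a \<noteq> g1 a" "f2 a \<noteq> g2 a"
      using par by blast
    then have "2 * 2 ^ r \<le> d f g + d f1 g1 + d f2 g2"
      by cases (use IH[of f g a] IH[of f1 g1 a] IH[of f2 g2 a] cw a(1) in linarith)+
    then show ?case unfolding split by simp
  qed
  also have "\<dots> = card {p. p < 3 ^ r \<and> f p \<noteq> g p}"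
    by (subst sum_of_bool_eq) (auto intro!: arg_cong[of _ _ card])
  finally show ?thesis .
qed

section \<open>The code as a 3CNF formula\<close>

text \<open>Each clause excludes one of the four assignments with an odd number of ones.\<close>

definition parity_clauses :: "nat \<times> nat \<times> nat \<Rightarrow> cnf" where
  "parity_clauses = (\<lambda>(a, b, c).
     [[(a, False), (b, True), (c, True)], [(a, True), (b, False), (c, True)],
      [(a, True), (b, True), (c, False)], [(a, False), (b, False), (c, False)]])"

text \<open>Clauses with two distinct literals are padded to length 3 by repeating one.\<close>

definition negation_clauses :: "nat \<Rightarrow> nat \<Rightarrow> cnf" where
  "negation_clauses N p =
     [[(p, True), (N + p, True), (N + p, True)], [(p, False), (N + p, False), (N + p, False)]]"

definition code_formula :: "nat \<Rightarrow> cnf" where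
  "code_formula r = concat (map parity_clauses (checks r))
     @ concat (map (negation_clauses (3 ^ r)) [0..<3 ^ r])"

lemma is_3cnf_code_formula: "is_3cnf (2 * 3 ^ r) (code_formula r)"
  using checks_bounded
  by (fastforce simp: is_3cnf_def code_formula_def parity_clauses_def negation_clauses_def)

lemma solutions_code_formula:
  "A \<in> solutions (2 * 3 ^ r) (code_formula r) \<longleftrightarrow>
     A \<subseteq> {..<2 * 3 ^ r} \<and> codeword r (\<lambda>p. p \<in> A) \<and> (\<forall>p<3 ^ r. 3 ^ r + p \<in> A \<longleftrightarrow> p \<notin> A)"
proof -
  have 1: "sat A (parity_clauses t) \<longleftrightarrow> (case t of (a, b, c) \<Rightarrow> (c \<in> A) = ((a \<in> A) \<noteq> (b \<in> A)))" for t
    by (cases t) (auto simp: sat_def parity_clauses_def)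
  have 2: "sat A (negation_clauses N p) \<longleftrightarrow> (N + p \<in> A \<longleftrightarrow> p \<notin> A)" for N p
    by (auto simp: sat_def negation_clauses_def)
  have "sat A (code_formula r) \<longleftrightarrow> (\<forall>t\<in>set (checks r). sat A (parity_clauses t)) \<and>
      (\<forall>p<3 ^ r. sat A (negation_clauses (3 ^ r) p))"
    by (auto simp: sat_def code_formula_def)
  then show ?thesis
    by (simp add: solutions_def codeword_def 1 2)
qed

lemma finite_solutions: "finite (solutions n \<Phi>)"
  by (rule finite_subset[of _ "Pow {..<n}"]) (auto simp: solutions_def)

lemma sum_solution:
  fixes f :: "nat \<Rightarrow> real"
  assumes "A \<in> solutions (2 * 3 ^ r) (code_formula r)"
  shows "sum f A = (\<Sum>p<3 ^ r. if p \<in> A then f p else f (3 ^ r + p))"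
proof -
  let ?N = "3 ^ r :: nat"
  have A: "A \<subseteq> {..<?N + ?N}" "\<forall>p<?N. ?N + p \<in> A \<longleftrightarrow> p \<notin> A"
    using assms by (auto simp: solutions_code_formula)
  have "sum f A = (\<Sum>p<?N + ?N. if p \<in> A then f p else 0)"
    using A(1) by (simp add: sum.If_cases Int_absorb1)
  also have "\<dots> = (\<Sum>p<?N. (if p \<in> A then f p else 0) + (if ?N + p \<in> A then f (?N + p) else 0))"
    by (simp only: sum_lessThan_add sum.distrib)
  also have "\<dots> = (\<Sum>p<?N. if p \<in> A then f p else f (?N + p))"
    using A(2) by (intro sum.cong) auto
  finally show ?thesis .
qed

section \<open>Weights and the optimum\<close>

definition target_weight :: "nat \<Rightarrow> nat set \<Rightarrow> nat \<Rightarrow> real" where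
  "target_weight r b x =
     (if x < 3 ^ r then (2 / 3) ^ r + of_bool (x \<in> info r \<and> x \<in> b)
      else if x < 2 * 3 ^ r then (2 / 3) ^ r + of_bool (x - 3 ^ r \<in> info r \<and> x - 3 ^ r \<notin> b)
      else 0)"

lemma valid_target_weight: "valid_weight (2 * 3 ^ r) (target_weight r b)"
  by (auto simp: valid_weight_def target_weight_def)

text \<open>The base weights give every solution the same
  \<open>3 ^ r * (2 / 3) ^ r = 2 ^ r\<close>, so the loss against \<open>2 * 2 ^ r\<close> counts
  the wrong information bits.\<close>

lemma wt_target_weight:
  assumes "A \<in> solutions (2 * 3 ^ r) (code_formula r)"
  shows "wt (target_weight r b) A = 2 * 2 ^ r - (\<Sum>j\<in>info r. of_bool ((j \<in> A) \<noteq> (j \<in> b)))"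
proof -
  have "wt (target_weight r b) A =
      (\<Sum>p<3 ^ r. (2 / 3) ^ r + (if p \<in> info r then 1 - of_bool ((p \<in> A) \<noteq> (p \<in> b)) else 0))"
    unfolding wt_def sum_solution[OF assms]
    by (intro sum.cong) (auto simp: target_weight_def)
  also have "\<dots> = 2 ^ r + (\<Sum>p\<in>info r. 1 - of_bool ((p \<in> A) \<noteq> (p \<in> b)))"
    using info_bounded[of r]
    by (simp add: sum.distrib sum.If_cases Int_absorb1 power_divide)
  also have "\<dots> = 2 * 2 ^ r - (\<Sum>j\<in>info r. of_bool ((j \<in> A) \<noteq> (j \<in> b)))"
    by (simp add: sum_subtractf card_info del: sum_of_bool_eq)
  finally show ?thesis .
qed

lemma solution_for_target:
  obtains A where "A \<in> solutions (2 * 3 ^ r) (code_formula r)" "\<forall>j\<in>info r. j \<in> A \<longleftrightarrow> j \<in> b"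
proof -
  obtain f where f: "codeword r f" "\<forall>p\<in>info r. f p = (p \<in> b)"
    using codeword_extension[of r "\<lambda>p. p \<in> b"] by blast
  define A where "A = {p. p < 3 ^ r \<and> f p} \<union> {p. 3 ^ r \<le> p \<and> p < 2 * 3 ^ r \<and> \<not> f (p - 3 ^ r)}"
  have "codeword r (\<lambda>p. p \<in> A)"
    using f(1) codeword_cong[of r "\<lambda>p. p \<in> A" f] by (simp add: A_def)
  then have "A \<in> solutions (2 * 3 ^ r) (code_formula r)"
    by (auto simp: solutions_code_formula A_def)
  moreover have "\<forall>j\<in>info r. j \<in> A \<longleftrightarrow> j \<in> b"
    using f(2) info_bounded[of r] by (auto simp: A_def)
  ultimately show thesis using that by blast
qed

lemma satisfiable_code_formula: "satisfiable (2 * 3 ^ r) (code_formula r)"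
  using solution_for_target[of r "{}"] by (auto simp: satisfiable_def)

lemma OPT_target_weight:
  "OPT (2 * 3 ^ r) (code_formula r) (target_weight r b) \<ge> 2 * 2 ^ r"
proof -
  obtain A where A: "A \<in> solutions (2 * 3 ^ r) (code_formula r)" "\<forall>j\<in>info r. j \<in> A \<longleftrightarrow> j \<in> b"
    using solution_for_target .
  have "wt (target_weight r b) A = 2 * 2 ^ r"
    using A(2) by (subst wt_target_weight[OF A(1)]) simp
  then show ?thesis
    unfolding OPT_def using A(1) finite_solutions by (intro Max_ge) (auto simp: image_iff intro!: bexI[of _ A])
qed

section \<open>Weighted distance between solutions\<close>

text \<open>Every variable in the symmetric difference costs at least the base weight, and the code
  distance makes that difference large. Nonnegativity serves the pairs of outputs that may
  agree.\<close>

lemma dw_solutions: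
  assumes "A \<in> solutions (2 * 3 ^ r) (code_formula r)" "B \<in> solutions (2 * 3 ^ r) (code_formula r)"
  shows "0 \<le> dw (A, target_weight r b) (B, target_weight r b')"
    and "p < 3 ^ r \<Longrightarrow> (p \<in> A) \<noteq> (p \<in> B) \<Longrightarrow>
           2 * (4 / 3) ^ r \<le> dw (A, target_weight r b) (B, target_weight r b')"
proof -
  let ?N = "3 ^ r :: nat" and ?\<mu> = "(2 / 3 :: real) ^ r"
  have AB: "A \<subseteq> {..<2 * ?N}" "B \<subseteq> {..<2 * ?N}" "codeword r (\<lambda>p. p \<in> A)" "codeword r (\<lambda>p. p \<in> B)"
    "\<forall>p<?N. ?N + p \<in> A \<longleftrightarrow> p \<notin> A" "\<forall>p<?N. ?N + p \<in> B \<longleftrightarrow> p \<notin> B"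
    using assms by (auto simp: solutions_code_formula)
  have fin: "finite A" "finite B" using AB finite_subset by blast+
  have low: "?\<mu> \<le> target_weight r b x" if "x < 2 * ?N" for x b
    using that by (auto simp: target_weight_def)
  have "(\<Sum>x\<in>A - B. target_weight r b x) \<ge> (\<Sum>x\<in>A - B. ?\<mu>)"
    using low AB by (intro sum_mono) auto
  moreover have "(\<Sum>x\<in>B - A. target_weight r b' x) \<ge> (\<Sum>x\<in>B - A. ?\<mu>)"
    using low AB by (intro sum_mono) auto
  moreover have "(\<Sum>x\<in>A \<inter> B. \<bar>target_weight r b x - target_weight r b' x\<bar>) \<ge> 0"
    by (intro sum_nonneg) auto
  ultimately have dw: "dw (A, target_weight r b) (B, target_weight r b') \<ge>
      real (card (A - B) + card (B - A)) * ?\<mu>"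
    unfolding dw_def Let_def fst_conv snd_conv of_nat_add distrib_right sum_constant by linarith
  have "0 \<le> real (card (A - B) + card (B - A)) * ?\<mu>" by simp
  then show "0 \<le> dw (A, target_weight r b) (B, target_weight r b')" using dw by linarith
  show "2 * (4 / 3) ^ r \<le> dw (A, target_weight r b) (B, target_weight r b')"
    if p: "p < ?N" "(p \<in> A) \<noteq> (p \<in> B)"
  proof -
    let ?D = "{p. p < ?N \<and> (p \<in> A) \<noteq> (p \<in> B)}"
    have D: "2 ^ r \<le> card ?D" using codeword_distance[OF AB(3,4) p] .
    \<comment> \<open>A differing code bit puts both its own variable and the negated one into the
      symmetric difference.\<close>
    have "2 * card ?D = card (?D \<union> (+) ?N ` ?D)"
      by (subst card_Un_disjoint) (auto simp: card_image)
    also have "\<dots> \<le> card ((A - B) \<union> (B - A))"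
      using AB(5,6) fin by (intro card_mono) auto
    also have "\<dots> = card (A - B) + card (B - A)"
      using fin by (intro card_Un_disjoint) auto
    finally have "2 * 2 ^ r \<le> card (A - B) + card (B - A)" using D by linarith
    then have "real (2 * 2 ^ r) * ?\<mu> \<le> real (card (A - B) + card (B - A)) * ?\<mu>"
      by (intro mult_right_mono) (simp_all only: of_nat_le_iff, simp)
    moreover have "real (2 * 2 ^ r) * ?\<mu> = 2 * (4 / 3) ^ r"
      by (simp flip: power_mult_distrib)
    ultimately show ?thesis using dw by linarith
  qed
qed

section \<open>Flipping one target bit\<close>

definition flip :: "nat \<Rightarrow> nat set \<Rightarrow> nat set" where
  "flip j b = (if j \<in> b then b - {j} else insert j b)"

lemma in_flip_iff: "i \<in> flip j b \<longleftrightarrow> (i \<in> b) \<noteq> (i = j)"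
  by (auto simp: flip_def)

text \<open>The extra weight 1 moves between the two literals of bit \<open>j\<close>, at positions
  \<open>j\<close> and \<open>3 ^ r + j\<close>.\<close>

lemma l1_dist_flip:
  assumes "j \<in> info r"
  shows "l1_dist (2 * 3 ^ r) (target_weight r b) (target_weight r (flip j b)) = 2"
proof -
  let ?N = "3 ^ r :: nat"
  have j: "j < ?N" using assms info_bounded by blast
  have "l1_dist (2 * ?N) (target_weight r b) (target_weight r (flip j b))
      = (\<Sum>x<?N + ?N. of_bool (x \<in> {j, ?N + j}))"
    unfolding l1_dist_def mult_2
    using assms j by (intro sum.cong) (auto simp: target_weight_def in_flip_iff)
  also have "\<dots> = 2"
  proof -
    have "{..<?N + ?N} \<inter> {x. x \<in> {j, ?N + j}} = {j, ?N + j}" using j by auto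
    then show ?thesis by (subst sum_of_bool_eq) simp_all
  qed
  finally show ?thesis .
qed

text \<open>For fixed \<open>j\<close>, \<open>flip j\<close> is an involution on
  \<open>Pow I\<close>, so both summands have the same average over \<open>b\<close>; averaged over
  \<open>j\<close> as well, their sum is at most \<open>2 * \<beta>\<close>.\<close>

lemma exists_stable_flip:
  fixes err :: "nat set \<Rightarrow> nat \<Rightarrow> real" and \<beta> :: real
  assumes "finite I" "I \<noteq> {}" and avg: "\<And>b. b \<subseteq> I \<Longrightarrow> (\<Sum>j\<in>I. err b j) \<le> \<beta> * card I"
  shows "\<exists>b\<subseteq>I. \<exists>j\<in>I. err b j + err (flip j b) j \<le> 2 * \<beta>"
proof (rule ccontr)
  assume "\<not> ?thesis"
  then have gt: "2 * \<beta> < err b j + err (flip j b) j" if "b \<in> Pow I" "j \<in> I" for b j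
    using that by (meson PowD not_le)
  have "(\<Sum>j\<in>I. \<Sum>b\<in>Pow I. 2 * \<beta>) < (\<Sum>j\<in>I. \<Sum>b\<in>Pow I. err b j + err (flip j b) j)"
    using assms gt by (intro sum_strict_mono) auto
  also have "\<dots> = (\<Sum>j\<in>I. \<Sum>b\<in>Pow I. 2 * err b j)"
  proof (rule sum.cong[OF refl])
    fix j assume "j \<in> I"
    then have "(\<Sum>b\<in>Pow I. err (flip j b) j) = (\<Sum>b\<in>Pow I. err b j)"
      by (intro sum.reindex_bij_witness[of _ "flip j" "flip j"]) (auto simp: flip_def)
    then show "(\<Sum>b\<in>Pow I. err b j + err (flip j b) j) = (\<Sum>b\<in>Pow I. 2 * err b j)"
      by (simp add: sum.distrib flip: sum_distrib_left)
  qed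
  also have "\<dots> = (\<Sum>b\<in>Pow I. 2 * (\<Sum>j\<in>I. err b j))"
    by (subst sum.swap) (simp add: sum_distrib_left)
  also have "\<dots> \<le> (\<Sum>b\<in>Pow I. 2 * (\<beta> * card I))"
    using avg by (intro sum_mono) auto
  finally show False by (simp add: mult_ac)
qed

section \<open>Lipschitz bound for an approximation algorithm\<close>

lemma lipschitz_const_code_formula:
  assumes alg: "approx_alg (1 / 16) alg"
  shows "lipschitz_const alg (2 * 3 ^ r) (code_formula r) \<ge> ereal (3 / 4 * (4 / 3) ^ r)"
proof -
  let ?n = "2 * 3 ^ r :: nat" and ?\<Phi> = "code_formula r"
  define P where "P b = alg ?n ?\<Phi> (target_weight r b)" for b
  define miss where "miss b j A = (of_bool ((j \<in> A) \<noteq> (j \<in> b)) :: real)" for b A :: "nat set" and j :: nat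
  define err where "err b j = measure_pmf.expectation (P b) (miss b j)" for b j
  have P: "set_pmf (P b) \<subseteq> solutions ?n ?\<Phi>"
    "measure_pmf.expectation (P b) (wt (target_weight r b)) \<ge> 15 / 16 * OPT ?n ?\<Phi> (target_weight r b)" for b
    using alg[unfolded approx_alg_def, rule_format, of ?n ?\<Phi> "target_weight r b"]
      is_3cnf_code_formula satisfiable_code_formula valid_target_weight
    by (auto simp: P_def)
  have finP: "finite (set_pmf (P b))" for b
    using P(1) finite_solutions by (rule finite_subset)
  \<comment> \<open>The expected loss is at most \<open>1 / 16\<close> of \<open>2 * 2 ^ r\<close>,
    which is \<open>1 / 8\<close> per information bit.\<close>
  have err: "(\<Sum>j\<in>info r. err b j) \<le> 1 / 8 * card (info r)" for b
  proof -
    have "15 / 16 * (2 * 2 ^ r) \<le> 15 / 16 * OPT ?n ?\<Phi> (target_weight r b)"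
      using OPT_target_weight[of r b] by linarith
    also have "\<dots> \<le> measure_pmf.expectation (P b) (wt (target_weight r b))" by (rule P(2))
    also have "\<dots> = measure_pmf.expectation (P b) (\<lambda>A. 2 * 2 ^ r - (\<Sum>j\<in>info r. miss b j A))"
      using P(1)[of b] wt_target_weight[of _ r b]
      by (intro integral_cong_AE) (simp_all add: AE_measure_pmf_iff miss_def subset_iff del: sum_of_bool_eq)
    also have "\<dots> = 2 * 2 ^ r - (\<Sum>j\<in>info r. err b j)"
      unfolding err_def
      by (simp add: Bochner_Integration.integral_diff Bochner_Integration.integral_sum
          integrable_measure_pmf_finite finP)
    finally show ?thesis by (simp add: card_info)
  qed
  obtain b j where j: "j \<in> info r" and bj: "err b j + err (flip j b) j \<le> 1 / 4"
    using exists_stable_flip[of "info r" err "1 / 8"] err finite_info card_info[of r] by force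
  let ?w = "target_weight r b" and ?w' = "target_weight r (flip j b)"
  have jN: "j < 3 ^ r" using j info_bounded by blast
  have EM: "EM (P b, ?w) (P (flip j b), ?w') \<ge> 3 / 2 * (4 / 3) ^ r"
    unfolding EM_def fst_conv snd_conv
  proof (rule cINF_greatest)
    \<comment> \<open>The independent coupling shows that the infimum is over a nonempty
      set.\<close>
    have "pair_pmf (P b) (P (flip j b)) \<in> couplings (P b) (P (flip j b))"
      by (simp add: couplings_def map_fst_pair_pmf map_snd_pair_pmf)
    then show "couplings (P b) (P (flip j b)) \<noteq> {}" by blast
  next
    fix q assume "q \<in> couplings (P b) (P (flip j b))"
    then have q: "map_pmf fst q = P b" "map_pmf snd q = P (flip j b)"
      by (auto simp: couplings_def)
    have supp: "set_pmf q \<subseteq> set_pmf (P b) \<times> set_pmf (P (flip j b))"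
      unfolding q[symmetric] by (force simp: image_iff)
    have finq: "finite (set_pmf q)"
      by (rule finite_subset[OF supp]) (simp add: finP)
    let ?K = "2 * (4 / 3 :: real) ^ r"
    \<comment> \<open>Union bound: in any coupling both outputs are right at \<open>j\<close> with
      probability at least \<open>3 / 4\<close>, and then they differ there, as the targets
      do.\<close>
    have "3 / 2 * (4 / 3) ^ r \<le> ?K * (1 - err b j - err (flip j b) j)"
      using mult_left_mono[of "3 / 4" "1 - err b j - err (flip j b) j" ?K] bj by simp
    also have "\<dots> = measure_pmf.expectation q (\<lambda>z. ?K * (1 - miss b j (fst z) - miss (flip j b) j (snd z)))"
      unfolding err_def q[symmetric]
      by (simp add: integrable_measure_pmf_finite finq)
    \<comment> \<open>Pointwise, the left side is \<open>?K\<close> if both outputs are right at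
      \<open>j\<close>, and at most 0 otherwise.\<close>
    also have "\<dots> \<le> measure_pmf.expectation q (\<lambda>(A, B). dw (A, ?w) (B, ?w'))"
    proof (rule integral_mono_AE)
      show "AE z in measure_pmf q. ?K * (1 - miss b j (fst z) - miss (flip j b) j (snd z))
          \<le> (case z of (A, B) \<Rightarrow> dw (A, ?w) (B, ?w'))"
      proof (unfold AE_measure_pmf_iff, intro ballI)
        fix z assume z: "z \<in> set_pmf q"
        obtain A B where AB: "z = (A, B)" by (cases z)
        have "A \<in> solutions ?n ?\<Phi>" "B \<in> solutions ?n ?\<Phi>"
          using z supp P(1) AB by blast+
        from dw_solutions(1)[OF this, of b "flip j b"] dw_solutions(2)[OF this jN, of b "flip j b"]
          zero_le_power[of "4 / 3 :: real" r]
        show "?K * (1 - miss b j (fst z) - miss (flip j b) j (snd z))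
          \<le> (case z of (A, B) \<Rightarrow> dw (A, ?w) (B, ?w'))"
          by (cases "j \<in> A"; cases "j \<in> B"; cases "j \<in> b") (simp_all add: AB miss_def in_flip_iff del: zero_le_power)
      qed
    qed (auto intro: integrable_measure_pmf_finite finq)
    finally show "3 / 2 * (4 / 3) ^ r \<le> measure_pmf.expectation q (\<lambda>(A, B). dw (A, ?w) (B, ?w'))" .
  qed
  have l1: "l1_dist ?n ?w ?w' = 2" using l1_dist_flip[OF j] .
  then have ne: "?w \<noteq> ?w'" by (auto simp: l1_dist_def)
  have "ereal (3 / 4 * (4 / 3) ^ r) \<le> ereal (EM (P b, ?w) (P (flip j b), ?w') / l1_dist ?n ?w ?w')"
    using EM l1 by simp
  also have "\<dots> \<le> lipschitz_const alg ?n ?\<Phi>"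
    unfolding lipschitz_const_def
    by (rule SUP_upper2[of "(?w, ?w')"]) (use ne valid_target_weight in \<open>auto simp: P_def\<close>)
  finally show ?thesis .
qed

section \<open>Choice of the constants\<close>

theorem mainTheorem5:
  shows "\<exists>\<epsilon>>0. \<exists>\<delta>>0. \<exists>c>0. \<forall>alg. approx_alg \<epsilon> alg \<longrightarrow>
           (\<forall>N. \<exists>n\<ge>N. \<exists>\<Phi>. is_3cnf n \<Phi> \<and> satisfiable n \<Phi> \<and>
              lipschitz_const alg n \<Phi> \<ge> ereal (c * real n powr \<delta>))"
proof -
  \<comment> \<open>Chosen so that \<open>3 powr \<delta> = 4 / 3\<close>, the growth rate of the
    bound per tensor factor.\<close>
  define \<delta> where "\<delta> = log 3 (4 / 3 :: real)"
  have \<delta>: "0 < \<delta>" "\<delta> \<le> 1"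
    by (simp_all add: \<delta>_def)
  \<comment> \<open>The factor \<open>2 powr \<delta>\<close> from \<open>n = 2 * 3 ^ r\<close> is
    at most 2, which halves \<open>3 / 4\<close> to \<open>3 / 8\<close>.\<close>
  have size: "3 / 8 * real (2 * 3 ^ r) powr \<delta> \<le> 3 / 4 * (4 / 3) ^ r" for r
  proof -
    have "real (2 * 3 ^ r) powr \<delta> = 2 powr \<delta> * (3 powr \<delta>) ^ r"
      by (simp add: powr_mult powr_power powr_powr mult_ac flip: powr_realpow)
    also have "\<dots> = 2 powr \<delta> * (4 / 3) ^ r"
      by (simp add: \<delta>_def)
    also have "\<dots> \<le> 2 * (4 / 3) ^ r"
      using powr_mono[of \<delta> 1 2] \<delta> by (intro mult_right_mono) auto
    finally show ?thesis by simp
  qed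
  have "\<exists>n\<ge>N. \<exists>\<Phi>. is_3cnf n \<Phi> \<and> satisfiable n \<Phi> \<and>
      lipschitz_const alg n \<Phi> \<ge> ereal (3 / 8 * real n powr \<delta>)"
    if "approx_alg (1 / 16) alg" for alg N
  proof (intro exI conjI)
    \<comment> \<open>The tensor power \<open>r = N\<close> already yields at least \<open>N\<close>
      variables.\<close>
    have "N < 3 ^ N" by (rule power_gt_expt) simp
    then show "N \<le> 2 * 3 ^ N" by linarith
    show "is_3cnf (2 * 3 ^ N) (code_formula N)" by (rule is_3cnf_code_formula)
    show "satisfiable (2 * 3 ^ N) (code_formula N)" by (rule satisfiable_code_formula)
    show "ereal (3 / 8 * real (2 * 3 ^ N) powr \<delta>) \<le> lipschitz_const alg (2 * 3 ^ N) (code_formula N)"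
      using lipschitz_const_code_formula[OF that, of N] size[of N]
      by (meson ereal_less_eq(3) order_trans)
  qed
  then show ?thesis
    using \<delta>(1) by (intro exI[of _ "1 / 16"] exI[of _ \<delta>] exI[of _ "3 / 8"] conjI allI impI) auto
qed

end
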